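(* Let $\lambda\in P^+$. The set $\mathcal T'(\lambda)$ of reverse semistandard Young tableaux of shape $\lambda$, endowed with $$\mathrm{wt}(T)=\sum_{i=1}^{n+1}|T|_i\epsilon_i,\quad \tilde e_iT=\phi^{-1}(\tilde f_{n+1-i}\phi(T)),\quad \tilde f_iT=\phi^{-1}(\tilde e_{n+1-i}\phi(T)),\quad \varepsilon_i(T)=\varphi_{n+1-i}(\phi(T)),\quad \varphi_i(T)=\varepsilon_{n+1-i}(\phi(T))$$ ($i\in I$), is a crystal of type $A_n$. Moreover, $\phi:\mathcal T'(\lambda)\to\mathcal T(\lambda)$ is a crystal anti-isomorphism, that is, a bijection satisfying, for all $T\in\mathcal T'(\lambda)$ and $i\in I$, $\phi(\tilde e_iT)=\tilde f_{n+1-i}\phi(T)$, $\phi(\tilde f_iT)=\tilde e_{n+1-i}\phi(T)$ (with $\phi(0)=0$), and $\mathrm{wt}(\phi(T))=w_0\cdot\mathrm{wt}(T)$, where $w_0$ acts by $\epsilon_j\mapsto\epsilon_{n+2-j}$.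
   Context: Fix $n$, $I=\{1,\dots,n\}$. Let $\epsilon_1,\dots,\epsilon_{n+1}$ be the standard basis of $\mathbb R^{n+1}$, $\alpha_i=\epsilon_i-\epsilon_{i+1}$, $\omega_i=\epsilon_1+\dots+\epsilon_i$, $P=\bigoplus_{i\in I}\mathbb Z\omega_i$ (integer combinations of the $\epsilon_j$ are regarded in $P$ modulo $\epsilon_1+\dots+\epsilon_{n+1}$), $P^+=\bigoplus\mathbb Z_{\ge0}\omega_i$, $\langle\alpha_i^\vee,\epsilon_j\rangle=\delta_{i,j}-\delta_{i+1,j}$. Write $\lambda=\sum_{i=1}^n a_i\omega_i$ and $\lambda_i=\sum_{j=i}^n a_j$; identify $\lambda$ with the Young diagram with rows $\lambda_1\ge\dots\ge\lambda_n$. A crystal of type $A_n$ is a set $B$ with maps $\mathrm{wt}:B\to P$, $\tilde e_i,\tilde f_i:B\to B\cup\{0\}$, $\varepsilon_i,\varphi_i:B\to\mathbb Z\cup\{-\infty\}$ ($i\in I$) such that: $\varphi_i(b)=\varepsilon_i(b)+\langle\alpha_i^\vee,\mathrm{wt}(b)\rangle$; if $\tilde e_ib\ne0$ then $\mathrm{wt}(\tilde e_ib)=\mathrm{wt}(b)+\alpha_i$, $\varepsilon_i(\tilde e_ib)=\varepsilon_i(b)-1$, $\varphi_i(\tilde e_ib)=\varphi_i(b)+1$; if $\tilde f_ib\neq0$ then $\mathrm{wt}(\tilde f_ib)=\mathrm{wt}(b)-\alpha_i$, $\varepsilon_i(\tilde f_ib)=\varepsilon_i(b)+1$, $\varphi_i(\tilde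 f_ib)=\varphi_i(b)-1$; $\tilde f_ib=b'$ iff $b=\tilde e_ib'$ for $b,b'\in B$; and $\tilde e_ib=\tilde f_ib=0$ if $\varphi_i(b)=-\infty$. $\mathcal T(\lambda)$ is the set of semistandard Young tableaux of shape $\lambda$ with entries in $\{1,\dots,n+1\}$ (rows weakly increasing, columns strictly increasing). It is a crystal (isomorphic to $\mathcal B(\lambda)$) as follows: read the boxes by the Far-Eastern reading (columns from right to left, each column from top to bottom); write $+$ for each entry $i$ and $-$ for each entry $i+1$; cancel successively all pairs $(+,-)$ ($+$ before $-$); the remaining sequence of $-$'s followed by $+$'s is the $i$-signature. $\tilde f_iT$ changes $i$ to $i+1$ in the box of the leftmost $+$ ($0$ if there is none); $\tilde e_iT$ changes $i+1$ to $i$ in the box of the rightmost $-$ ($0$ if there is none); $\varepsilon_i(T)$ and $\varphi_i(T)$ are the numbers of $-$'s and $+$'s in the $i$-signature; $\mathrm{wt}(T)=\sum_{i=1}^{n+1}|T|_i\epsilon_i$, where $|T|_i$ denotes the number of entries equal to $i$ in a tableau $T$. $\mathcal T'(\lambda)$ is the set of fillings of $\lambda$ with entries in $\{1,\dots,n+1\}$ weakly decreasing along rows and strictly decreasing down columns, and $\phi:\mathcal T'(\lambda)\to\mathcal T(\lambda)$ replaces each entry $a$ by $n+2-a$ (with $\phi^{-1}(0)=0$). *)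

theory Defs
  imports Main "HOL-Library.FuncSet" "HOL-Library.Extended" "HOL-Library.Function_Algebras"
begin

section \<open>The weight lattice of type A\<close>

text \<open>
  A vector of \<open>\<int>\<^bsup>n+1\<^esup>\<close> is a function of type \<open>nat \<Rightarrow> int\<close> vanishing outside \<open>{1..n+1}\<close>, the value
  at \<open>j\<close> being the coefficient of \<open>\<epsilon>\<^sub>j\<close>.  Addition is the pointwise one of \<open>Function_Algebras\<close>.
\<close>

definition epsilon :: "nat \<Rightarrow> nat \<Rightarrow> int" where
  "epsilon j = (\<lambda>k. of_bool (k = j))"

definition lincomb :: "nat set \<Rightarrow> (nat \<Rightarrow> int) \<Rightarrow> (nat \<Rightarrow> nat \<Rightarrow> int) \<Rightarrow> nat \<Rightarrow> int" where
  "lincomb J c v = (\<Sum>j\<in>J. (\<lambda>k. c j * v j k))"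

definition simple_root :: "nat \<Rightarrow> nat \<Rightarrow> int" where
  "simple_root i = epsilon i - epsilon (i + 1)"

definition fund_weight :: "nat \<Rightarrow> nat \<Rightarrow> int" where
  "fund_weight i = (\<Sum>j\<in>{1..i}. epsilon j)"

definition weight_lattice :: "nat \<Rightarrow> (nat \<Rightarrow> int) set" where
  "weight_lattice n = {lincomb {1..n} a fund_weight | a. True}"

definition dominant_weights :: "nat \<Rightarrow> (nat \<Rightarrow> int) set" where
  "dominant_weights n = {lincomb {1..n} a fund_weight | a. \<forall>i\<in>{1..n}. a i \<ge> 0}"

text \<open>
  Integer combinations of the \<open>\<epsilon>\<^sub>j\<close> are regarded in the weight lattice modulo
  \<open>\<epsilon>\<^sub>1 + \<dots> + \<epsilon>\<^bsub>n+1\<^esub>\<close>.  Each class contains exactly one element of \<open>weight_lattice n\<close>, namely the one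
  with vanishing coefficient of \<open>\<epsilon>\<^bsub>n+1\<^esub>\<close>; \<open>to_P n\<close> selects it.
\<close>

definition to_P :: "nat \<Rightarrow> (nat \<Rightarrow> int) \<Rightarrow> nat \<Rightarrow> int" where
  "to_P n v = (\<lambda>j. if j \<in> {1..n+1} then v j - v (n + 1) else 0)"

text \<open>The linear extension of \<open>\<langle>\<alpha>\<^sub>i\<^sup>\<or>, \<epsilon>\<^sub>j\<rangle> = \<delta>\<^bsub>i,j\<^esub> - \<delta>\<^bsub>i+1,j\<^esub>\<close>.\<close>

definition coroot_pairing :: "nat \<Rightarrow> nat \<Rightarrow> (nat \<Rightarrow> int) \<Rightarrow> int" where
  "coroot_pairing n i v = (\<Sum>j\<in>{1..n+1}. v j * (of_bool (i = j) - of_bool (i + 1 = j)))"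

text \<open>The linear extension of \<open>\<epsilon>\<^sub>j \<mapsto> \<epsilon>\<^bsub>n+2-j\<^esub>\<close>, regarded in the weight lattice.\<close>

definition w0_action :: "nat \<Rightarrow> (nat \<Rightarrow> int) \<Rightarrow> nat \<Rightarrow> int" where
  "w0_action n v = to_P n (lincomb {1..n+1} v (\<lambda>j. epsilon (n + 2 - j)))"

lemma lincomb_apply: "lincomb J c v k = (\<Sum>j\<in>J. c j * v j k)"
  unfolding lincomb_def by (induction J rule: infinite_finite_induct) auto

lemma fund_weight_apply: "fund_weight i k = of_bool (k \<in> {1..i})"
proof -
  have "(\<Sum>j\<in>A. epsilon j) k = of_bool (k \<in> A)" if "finite A" for A
    using that by (induction A rule: finite_induct) (auto simp: epsilon_def)
  thus ?thesis by (simp add: fund_weight_def)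
qed

text \<open>
  In \<open>\<epsilon>\<close>-coordinates, \<open>\<lambda> = \<Sum> a\<^sub>i \<omega>\<^sub>i\<close> has \<open>r\<close>-th coordinate \<open>\<lambda>\<^sub>r = \<Sum>\<^bsub>j\<ge>r\<^esub> a\<^sub>j\<close>.
\<close>

lemma lincomb_fund_weight_apply:
  "lincomb {1..n} a fund_weight r = (if r \<ge> 1 then \<Sum>j\<in>{r..n}. a j else 0)"
proof (cases "r \<ge> 1")
  case True
  have "(\<Sum>j\<in>{1..n}. a j * fund_weight j r) = (\<Sum>j\<in>{r..n}. a j * fund_weight j r)"
    by (rule sum.mono_neutral_right) (use True in \<open>auto simp: fund_weight_apply\<close>)
  also have "\<dots> = (\<Sum>j\<in>{r..n}. a j)"
    by (rule sum.cong) (use True in \<open>auto simp: fund_weight_apply\<close>)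
  finally show ?thesis using True by (simp add: lincomb_apply)
qed (auto simp: lincomb_apply fund_weight_apply)

lemma weight_lattice_iff:
  "v \<in> weight_lattice n \<longleftrightarrow> (\<forall>j. j \<notin> {1..n} \<longrightarrow> v j = 0)"
proof
  assume "v \<in> weight_lattice n"
  thus "\<forall>j. j \<notin> {1..n} \<longrightarrow> v j = 0"
    by (auto simp: weight_lattice_def lincomb_fund_weight_apply simp del: One_nat_def)
next
  assume v: "\<forall>j. j \<notin> {1..n} \<longrightarrow> v j = 0"
  have *: "(\<Sum>j\<in>{r..n}. v j - v (j + 1)) = v r" for r
  proof (cases "r \<le> n + 1")
    case True
    hence "(\<Sum>j\<in>{r..n}. v (Suc j) - v j) = v (Suc n) - v r"
      by (intro sum_Suc_diff) auto
    moreover have "v (Suc n) = 0" using v by auto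
    moreover have "(\<Sum>j\<in>{r..n}. v j - v (j + 1)) = - (\<Sum>j\<in>{r..n}. v (Suc j) - v j)"
      by (simp add: sum_negf[symmetric])
    ultimately show ?thesis by linarith
  next
    case False
    thus ?thesis using v by auto
  qed
  have "v = lincomb {1..n} (\<lambda>j. v j - v (j + 1)) fund_weight"
    using v * by (intro ext) (auto simp: lincomb_fund_weight_apply simp del: One_nat_def)
  thus "v \<in> weight_lattice n" by (auto simp: weight_lattice_def)
qed

lemma to_P_in_weight_lattice: "to_P n v \<in> weight_lattice n"
  by (auto simp: weight_lattice_iff to_P_def le_Suc_eq)

lemma to_P_ident: "v \<in> weight_lattice n \<Longrightarrow> to_P n v = v"
  by (auto simp: weight_lattice_iff to_P_def fun_eq_iff)

lemma to_P_eq_iff: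
  "to_P n u = to_P n v \<longleftrightarrow> (\<exists>c. \<forall>j\<in>{1..n+1}. u j = v j + c)"
proof
  assume *: "to_P n u = to_P n v"
  have "u j = v j + (u (n + 1) - v (n + 1))" if "j \<in> {1..n+1}" for j
    using fun_cong[OF *, of j] that by (simp add: to_P_def)
  thus "\<exists>c. \<forall>j\<in>{1..n+1}. u j = v j + c" by blast
next
  assume "\<exists>c. \<forall>j\<in>{1..n+1}. u j = v j + c"
  then obtain c where "\<forall>j\<in>{1..n+1}. u j = v j + c" ..
  thus "to_P n u = to_P n v" by (auto simp: to_P_def fun_eq_iff)
qed

section \<open>Crystals of type A\<close>

text \<open>
  \<open>\<int> \<union> {-\<infinity>}\<close> is the set of elements of \<open>int extended\<close> different from \<open>\<infinity>\<close>, and \<open>B \<union> {0}\<close> is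
  rendered by the option type, with \<open>None\<close> in the role of \<open>0\<close>.
\<close>

record 'b crystal =
  elems :: "'b set"
  wt :: "'b \<Rightarrow> nat \<Rightarrow> int"
  e_op :: "nat \<Rightarrow> 'b \<Rightarrow> 'b option"
  f_op :: "nat \<Rightarrow> 'b \<Rightarrow> 'b option"
  eps :: "nat \<Rightarrow> 'b \<Rightarrow> int extended"
  phi :: "nat \<Rightarrow> 'b \<Rightarrow> int extended"

locale crystal_A =
  fixes n :: nat and B :: "'b crystal"
  assumes wt_closed: "b \<in> elems B \<Longrightarrow> wt B b \<in> weight_lattice n"
    and e_closed: "\<lbrakk>i \<in> {1..n}; b \<in> elems B; e_op B i b = Some b'\<rbrakk> \<Longrightarrow> b' \<in> elems B"
    and f_closed: "\<lbrakk>i \<in> {1..n}; b \<in> elems B; f_op B i b = Some b'\<rbrakk> \<Longrightarrow> b' \<in> elems B"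
    and eps_closed: "\<lbrakk>i \<in> {1..n}; b \<in> elems B\<rbrakk> \<Longrightarrow> eps B i b \<noteq> \<infinity>"
    and phi_closed: "\<lbrakk>i \<in> {1..n}; b \<in> elems B\<rbrakk> \<Longrightarrow> phi B i b \<noteq> \<infinity>"
    and phi_eps: "\<lbrakk>i \<in> {1..n}; b \<in> elems B\<rbrakk> \<Longrightarrow>
          phi B i b = eps B i b + Fin (coroot_pairing n i (wt B b))"
    and wt_e: "\<lbrakk>i \<in> {1..n}; b \<in> elems B; e_op B i b = Some b'\<rbrakk> \<Longrightarrow>
          wt B b' = wt B b + to_P n (simple_root i)"
    and eps_e: "\<lbrakk>i \<in> {1..n}; b \<in> elems B; e_op B i b = Some b'\<rbrakk> \<Longrightarrow> eps B i b' = eps B i b - 1"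
    and phi_e: "\<lbrakk>i \<in> {1..n}; b \<in> elems B; e_op B i b = Some b'\<rbrakk> \<Longrightarrow> phi B i b' = phi B i b + 1"
    and wt_f: "\<lbrakk>i \<in> {1..n}; b \<in> elems B; f_op B i b = Some b'\<rbrakk> \<Longrightarrow>
          wt B b' = wt B b - to_P n (simple_root i)"
    and eps_f: "\<lbrakk>i \<in> {1..n}; b \<in> elems B; f_op B i b = Some b'\<rbrakk> \<Longrightarrow> eps B i b' = eps B i b + 1"
    and phi_f: "\<lbrakk>i \<in> {1..n}; b \<in> elems B; f_op B i b = Some b'\<rbrakk> \<Longrightarrow> phi B i b' = phi B i b - 1"
    and f_iff_e: "\<lbrakk>i \<in> {1..n}; b \<in> elems B; b' \<in> elems B\<rbrakk> \<Longrightarrow>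
          f_op B i b = Some b' \<longleftrightarrow> e_op B i b' = Some b"
    and phi_minf: "\<lbrakk>i \<in> {1..n}; b \<in> elems B; phi B i b = -\<infinity>\<rbrakk> \<Longrightarrow>
          e_op B i b = None \<and> f_op B i b = None"

text \<open>The convention \<open>F(0) = 0\<close> is \<open>map_option\<close>.\<close>

definition crystal_anti_iso :: "nat \<Rightarrow> ('b \<Rightarrow> 'c) \<Rightarrow> 'b crystal \<Rightarrow> 'c crystal \<Rightarrow> bool" where
  "crystal_anti_iso n F B C \<longleftrightarrow>
     bij_betw F (elems B) (elems C) \<and>
     (\<forall>b\<in>elems B.
        (\<forall>i\<in>{1..n}. map_option F (e_op B i b) = f_op C (n + 1 - i) (F b) \<and>
                    map_option F (f_op B i b) = e_op C (n + 1 - i) (F b)) \<and>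
        wt C (F b) = w0_action n (wt B b))"

section \<open>Tableaux\<close>

text \<open>
  Boxes are pairs (row, column), counted from 1.  By \<open>lincomb_fund_weight_apply\<close> the row lengths of
  the diagram of a dominant weight are its \<open>\<epsilon>\<close>-coordinates.
\<close>

type_synonym box = "nat \<times> nat"
type_synonym filling = "box \<Rightarrow> nat"

definition young_diagram :: "nat \<Rightarrow> (nat \<Rightarrow> int) \<Rightarrow> box set" where
  "young_diagram n lam = {(r, c). r \<in> {1..n} \<and> 1 \<le> c \<and> int c \<le> lam r}"

definition fillings :: "nat \<Rightarrow> (nat \<Rightarrow> int) \<Rightarrow> filling set" where
  "fillings n lam = young_diagram n lam \<rightarrow>\<^sub>E {1..n+1}"

definition ssyt :: "nat \<Rightarrow> (nat \<Rightarrow> int) \<Rightarrow> filling set" where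
  "ssyt n lam = {T \<in> fillings n lam.
     (\<forall>r c c'. (r, c) \<in> young_diagram n lam \<and> (r, c') \<in> young_diagram n lam \<and> c < c' \<longrightarrow>
        T (r, c) \<le> T (r, c')) \<and>
     (\<forall>r r' c. (r, c) \<in> young_diagram n lam \<and> (r', c) \<in> young_diagram n lam \<and> r < r' \<longrightarrow>
        T (r, c) < T (r', c))}"

definition reverse_ssyt :: "nat \<Rightarrow> (nat \<Rightarrow> int) \<Rightarrow> filling set" where
  "reverse_ssyt n lam = {T \<in> fillings n lam.
     (\<forall>r c c'. (r, c) \<in> young_diagram n lam \<and> (r, c') \<in> young_diagram n lam \<and> c < c' \<longrightarrow>
        T (r, c) \<ge> T (r, c')) \<and>
     (\<forall>r r' c. (r, c) \<in> young_diagram n lam \<and> (r', c) \<in> young_diagram n lam \<and> r < r' \<longrightarrow>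
        T (r, c) > T (r', c))}"

definition entry_count :: "nat \<Rightarrow> (nat \<Rightarrow> int) \<Rightarrow> filling \<Rightarrow> nat \<Rightarrow> nat" where
  "entry_count n lam T a = card {x \<in> young_diagram n lam. T x = a}"

definition tableau_wt :: "nat \<Rightarrow> (nat \<Rightarrow> int) \<Rightarrow> filling \<Rightarrow> nat \<Rightarrow> int" where
  "tableau_wt n lam T = to_P n (lincomb {1..n+1} (\<lambda>a. int (entry_count n lam T a)) epsilon)"

definition far_eastern_reading :: "nat \<Rightarrow> (nat \<Rightarrow> int) \<Rightarrow> box list" where
  "far_eastern_reading n lam =
     [(r, c). c \<leftarrow> rev [1..<nat (lam 1) + 1], r \<leftarrow> [1..<n + 1], (r, c) \<in> young_diagram n lam]"

section \<open>Signatures\<close>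

text \<open>Each sign carries the box it comes from.\<close>

datatype sign = Pls | Mns

definition sign_word :: "nat \<Rightarrow> (nat \<Rightarrow> int) \<Rightarrow> nat \<Rightarrow> filling \<Rightarrow> (sign \<times> box) list" where
  "sign_word n lam i T =
     [(if T x = i then Pls else Mns, x). x \<leftarrow> far_eastern_reading n lam, T x = i \<or> T x = i + 1]"

inductive cancel_step :: "(sign \<times> 'x) list \<Rightarrow> (sign \<times> 'x) list \<Rightarrow> bool" where
  "cancel_step (u @ [(Pls, x), (Mns, y)] @ v) (u @ v)"

definition fully_cancelled :: "(sign \<times> 'x) list \<Rightarrow> (sign \<times> 'x) list" where
  "fully_cancelled w = (THE w'. cancel_step\<^sup>*\<^sup>* w w' \<and> (\<nexists>w''. cancel_step w' w''))"

text \<open>The fully cancelled word exists, does not depend on the order of cancellations, and is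
  computed by the following recursion.\<close>

fun push_sign :: "sign \<times> 'x \<Rightarrow> (sign \<times> 'x) list \<Rightarrow> (sign \<times> 'x) list" where
  "push_sign (Pls, x) ((Mns, y) # w) = w"
| "push_sign s w = s # w"

lemma foldr_push_sign_step: "cancel_step w w' \<Longrightarrow> foldr push_sign w [] = foldr push_sign w' []"
proof (induction rule: cancel_step.induct)
  case (1 u x y v)
  show ?case by (cases "foldr push_sign v []") simp_all
qed

lemma cancel_step_Cons: "cancel_step w w' \<Longrightarrow> cancel_step (s # w) (s # w')"
  by (metis append_Cons cancel_step.simps)

lemma cancel_steps_Cons: "cancel_step\<^sup>*\<^sup>* w w' \<Longrightarrow> cancel_step\<^sup>*\<^sup>* (s # w) (s # w')"
  by (induction rule: rtranclp_induct) (auto intro: cancel_step_Cons rtranclp.rtrancl_into_rtrancl)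

lemma cancel_steps_foldr: "cancel_step\<^sup>*\<^sup>* w (foldr push_sign w [])"
proof (induction w)
  case (Cons s w)
  let ?r = "foldr push_sign w []"
  have "cancel_step\<^sup>*\<^sup>* (s # ?r) (push_sign s ?r)"
  proof (cases "(s, ?r)" rule: push_sign.cases)
    case (1 x y v)
    hence "s # ?r = [] @ [(Pls, x), (Mns, y)] @ v" "push_sign s ?r = [] @ v" by simp_all
    thus ?thesis by (metis cancel_step.intros r_into_rtranclp)
  qed auto
  with cancel_steps_Cons[OF Cons] have "cancel_step\<^sup>*\<^sup>* (s # w) (push_sign s ?r)"
    by (rule rtranclp_trans)
  thus ?case by simp
qed simp

lemma irreducible_Cons:
  assumes "\<nexists>w''. cancel_step (s # w) w''"
  shows "\<nexists>w''. cancel_step w w''" "push_sign s w = s # w"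
proof -
  show "\<nexists>w''. cancel_step w w''" using assms cancel_step_Cons by blast
  show "push_sign s w = s # w"
  proof (cases "(s, w)" rule: push_sign.cases)
    case (1 x y v)
    hence "s # w = [] @ [(Pls, x), (Mns, y)] @ v" by simp
    thus ?thesis using assms by (metis cancel_step.intros)
  qed auto
qed

lemma foldr_irreducible: "\<nexists>w''. cancel_step w w'' \<Longrightarrow> foldr push_sign w [] = w"
proof (induction w)
  case (Cons s w)
  thus ?case using irreducible_Cons[OF Cons.prems] by simp
qed simp

lemma cancel_step_length: "cancel_step w w' \<Longrightarrow> length w' < length w"
  by (induction rule: cancel_step.induct) simp

lemma irreducible_exists: "\<exists>w'. cancel_step\<^sup>*\<^sup>* w w' \<and> (\<nexists>w''. cancel_step w' w'')"
proof (induction w rule: measure_induct_rule[of length])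
  case (less w)
  show ?case
  proof (cases "\<exists>v. cancel_step w v")
    case True
    then obtain v where v: "cancel_step w v" ..
    from less[OF cancel_step_length[OF v]] obtain w'
      where "cancel_step\<^sup>*\<^sup>* v w'" "\<nexists>w''. cancel_step w' w''" by blast
    thus ?thesis using converse_rtranclp_into_rtranclp[of cancel_step, OF v] by blast
  next
    case False
    thus ?thesis by blast
  qed
qed

lemma fully_cancelled_unique:
  assumes "cancel_step\<^sup>*\<^sup>* w w'" "\<nexists>w''. cancel_step w' w''"
  shows "w' = foldr push_sign w []"
proof -
  have "foldr push_sign w [] = foldr push_sign w' []"
    using assms(1) by (induction rule: rtranclp_induct) (auto dest: foldr_push_sign_step)
  thus ?thesis using foldr_irreducible[OF assms(2)] by simp
qed

lemma fully_cancelled_eq: "fully_cancelled w = foldr push_sign w []"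
proof -
  obtain w' where w': "cancel_step\<^sup>*\<^sup>* w w'" "\<nexists>w''. cancel_step w' w''"
    using irreducible_exists by blast
  have "fully_cancelled w = w'"
    unfolding fully_cancelled_def
  proof (rule the_equality)
    show "cancel_step\<^sup>*\<^sup>* w w' \<and> (\<nexists>w''. cancel_step w' w'')" using w' by blast
    show "v = w'" if "cancel_step\<^sup>*\<^sup>* w v \<and> (\<nexists>w''. cancel_step v w'')" for v
      using that fully_cancelled_unique[of w v] fully_cancelled_unique[OF w'] by simp
  qed
  thus ?thesis using fully_cancelled_unique[OF w'] by simp
qed

definition signature :: "nat \<Rightarrow> (nat \<Rightarrow> int) \<Rightarrow> nat \<Rightarrow> filling \<Rightarrow> (sign \<times> box) list" where
  "signature n lam i T = fully_cancelled (sign_word n lam i T)"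

definition sig_boxes :: "sign \<Rightarrow> (sign \<times> box) list \<Rightarrow> box list" where
  "sig_boxes s w = [x. (t, x) \<leftarrow> w, t = s]"

definition tableau_f :: "nat \<Rightarrow> (nat \<Rightarrow> int) \<Rightarrow> nat \<Rightarrow> filling \<Rightarrow> filling option" where
  "tableau_f n lam i T =
     (let xs = sig_boxes Pls (signature n lam i T)
      in if xs = [] then None else Some (T(hd xs := i + 1)))"

definition tableau_e :: "nat \<Rightarrow> (nat \<Rightarrow> int) \<Rightarrow> nat \<Rightarrow> filling \<Rightarrow> filling option" where
  "tableau_e n lam i T =
     (let xs = sig_boxes Mns (signature n lam i T)
      in if xs = [] then None else Some (T(last xs := i)))"

definition tableau_eps :: "nat \<Rightarrow> (nat \<Rightarrow> int) \<Rightarrow> nat \<Rightarrow> filling \<Rightarrow> int extended" where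
  "tableau_eps n lam i T = Fin (int (length (sig_boxes Mns (signature n lam i T))))"

definition tableau_phi :: "nat \<Rightarrow> (nat \<Rightarrow> int) \<Rightarrow> nat \<Rightarrow> filling \<Rightarrow> int extended" where
  "tableau_phi n lam i T = Fin (int (length (sig_boxes Pls (signature n lam i T))))"

definition ssyt_crystal :: "nat \<Rightarrow> (nat \<Rightarrow> int) \<Rightarrow> filling crystal" where
  "ssyt_crystal n lam =
     \<lparr>elems = ssyt n lam,
      wt = tableau_wt n lam,
      e_op = tableau_e n lam,
      f_op = tableau_f n lam,
      eps = tableau_eps n lam,
      phi = tableau_phi n lam\<rparr>"

section \<open>Reverse tableaux\<close>

definition complement_map :: "nat \<Rightarrow> (nat \<Rightarrow> int) \<Rightarrow> filling \<Rightarrow> filling" where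
  "complement_map n lam T = (\<lambda>x\<in>young_diagram n lam. n + 2 - T x)"

definition reverse_ssyt_crystal :: "nat \<Rightarrow> (nat \<Rightarrow> int) \<Rightarrow> filling crystal" where
  "reverse_ssyt_crystal n lam =
     (let F = complement_map n lam;
          F_inv = inv_into (reverse_ssyt n lam) F
      in \<lparr>elems = reverse_ssyt n lam,
          wt = tableau_wt n lam,
          e_op = (\<lambda>i T. map_option F_inv (tableau_f n lam (n + 1 - i) (F T))),
          f_op = (\<lambda>i T. map_option F_inv (tableau_e n lam (n + 1 - i) (F T))),
          eps = (\<lambda>i T. tableau_phi n lam (n + 1 - i) (F T)),
          phi = (\<lambda>i T. tableau_eps n lam (n + 1 - i) (F T))\<rparr>)"

end

theory Submission
  imports Defs
begin

text \<open>
  The structure on reverse tableaux is the one of semistandard tableaux, transported along the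
  complement of the entries with the roles of raising and lowering exchanged and \<open>i\<close> replaced by
  \<open>n + 1 - i\<close>.  Such a transport turns any crystal into a crystal, provided that weights are
  transported by \<open>w\<^sub>0\<close>: this works because \<open>w\<^sub>0\<close> is a linear involution of the weight lattice that
  sends \<open>\<alpha>\<close> with index \<open>n + 1 - i\<close> to \<open>-\<alpha>\<^sub>i\<close>, so that lowering by the former root becomes raising by
  the latter (\<open>crystal_A_twist\<close>).  Complementing moves the number of entries \<open>a\<close> to
  \<open>n + 2 - a\<close>, which is exactly the action of \<open>w\<^sub>0\<close> on weights.

  What remains is that the semistandard tableaux themselves form a crystal (\<open>crystal_A_ssyt\<close>).  The key
  is to describe the letter that an operator changes without reference to the cancelled word: it is a
  letter of the sign word \<open>u @ s # v\<close> such that no \<open>+\<close> of \<open>u\<close> survives the cancellations inside \<open>u\<close> and no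
  \<open>-\<close> of \<open>v\<close> survives those inside \<open>v\<close> (\<open>splits_at\<close>).  This condition does not mention the sign \<open>s\<close>,
  so changing \<open>s\<close> from \<open>+\<close> to \<open>-\<close> yields a word split at the same place.  Hence the two operators are
  mutually inverse and each moves one sign of the signature from one kind to the other.

  The condition also explains why the result is again semistandard.  It forbids a \<open>+\<close> immediately before
  the changed letter and a \<open>-\<close> immediately after it.  If the changed tableau violated semistandardness, the
  offending box, with an entry \<open>i\<close> or \<open>i + 1\<close> in the same row or column, would lead to a forbidden
  neighbour in the Far-Eastern reading: the boxes read in between carry no sign, unless there is already an
  offending box in the column of the changed one.
\<close>

section \<open>Cancellation of signs\<close>

lemma fully_cancelled_Nil [simp]: "fully_cancelled [] = []"
  by (simp add: fully_cancelled_eq)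

lemma fully_cancelled_Cons: "fully_cancelled (s # w) = push_sign s (fully_cancelled w)"
  by (simp add: fully_cancelled_eq)

lemma push_sign_dichotomy:
  obtains (cancel) x y r where "s = (Pls, x)" "w = (Mns, y) # r" "push_sign s w = r"
  | (keep) "push_sign s w = s # w" "fst s = Pls \<Longrightarrow> w = [] \<or> fst (hd w) = Pls"
  by (cases "(s, w)" rule: push_sign.cases) auto

lemma foldr_push_sign_cancel_step:
  "cancel_step w w' \<Longrightarrow> foldr push_sign w r = foldr push_sign w' r"
proof (induction rule: cancel_step.induct)
  case (1 u x y v)
  show ?case by (cases "foldr push_sign v r") simp_all
qed

text \<open>
  Cancelling inside the left factor first is allowed because the order of cancellations is irrelevant.
\<close>

lemma fully_cancelled_append:
  "fully_cancelled (u @ v) = foldr push_sign (fully_cancelled u) (fully_cancelled v)"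
proof -
  have "cancel_step\<^sup>*\<^sup>* u (fully_cancelled u)"
    by (simp add: fully_cancelled_eq cancel_steps_foldr)
  hence "foldr push_sign u r = foldr push_sign (fully_cancelled u) r" for r
    by (induction rule: rtranclp_induct) (metis foldr_push_sign_cancel_step)+
  from this[of "foldr push_sign v []"] show ?thesis by (simp only: fully_cancelled_eq foldr_append o_apply)
qed

definition all_sign :: "sign \<Rightarrow> (sign \<times> 'x) list \<Rightarrow> bool" where
  "all_sign s w \<longleftrightarrow> (\<forall>p\<in>set w. fst p = s)"

lemma all_sign_simps [simp]:
  "all_sign s []" "all_sign s (p # w) \<longleftrightarrow> fst p = s \<and> all_sign s w"
  "all_sign s (u @ v) \<longleftrightarrow> all_sign s u \<and> all_sign s v"
  by (auto simp: all_sign_def)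

lemma foldr_push_sign_Mns: "all_sign Mns a \<Longrightarrow> foldr push_sign a r = a @ r"
  by (induction a) auto

lemma push_sign_Pls: "all_sign Pls w \<Longrightarrow> push_sign s w = s # w"
  by (cases s w rule: push_sign_dichotomy) auto

lemma fully_cancelled_form:
  obtains a b where "fully_cancelled w = a @ b" "all_sign Mns a" "all_sign Pls b"
proof (induction w arbitrary: thesis)
  case Nil
  from Nil[of "[]" "[]"] show ?case by simp
next
  case (Cons s w)
  from Cons.IH obtain a b where ab: "fully_cancelled w = a @ b" "all_sign Mns a" "all_sign Pls b" .
  obtain t x where s: "s = (t, x)" by (cases s)
  show ?case
  proof (cases t)
    case Mns
    show ?thesis
      by (rule Cons.prems[of "s # a" b]) (use ab s Mns in \<open>auto simp: fully_cancelled_Cons\<close>)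
  next
    case Pls
    show ?thesis
    proof (cases a)
      case Nil
      show ?thesis
        by (rule Cons.prems[of "[]" "s # b"])
          (use ab s Pls Nil in \<open>auto simp: fully_cancelled_Cons push_sign_Pls\<close>)
    next
      case (Cons p a')
      show ?thesis
        by (rule Cons.prems[of a' b])
          (use ab s Pls Cons in \<open>cases p, auto simp: fully_cancelled_Cons\<close>)
    qed
  qed
qed

text \<open>
  A letter that survives is never enclosed by a cancelled pair, so no pair of cancelled letters has one
  member on each side of it, and the factors to its left and right cancel independently of each other.
\<close>

lemma fully_cancelled_split:
  "fully_cancelled w = a @ s # b \<Longrightarrow>
   \<exists>u v. w = u @ s # v \<and> fully_cancelled u = a \<and> fully_cancelled v = b"
proof (induction w arbitrary: a)
  case (Cons t w)
  show ?case
  proof (cases t "fully_cancelled w" rule: push_sign_dichotomy)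
    case (cancel x y r)
    hence "fully_cancelled w = ((Mns, y) # a) @ s # b"
      using Cons.prems by (auto simp: fully_cancelled_Cons)
    from Cons.IH[OF this] obtain u v where
      uv: "w = u @ s # v" "fully_cancelled u = (Mns, y) # a" "fully_cancelled v = b" by blast
    hence "t # w = (t # u) @ s # v" "fully_cancelled (t # u) = a"
      using cancel by (simp_all add: fully_cancelled_Cons)
    with uv(3) show ?thesis by (intro exI[of _ "t # u"] exI[of _ v]) simp
  next
    case keep
    hence *: "t # fully_cancelled w = a @ s # b"
      using Cons.prems by (auto simp: fully_cancelled_Cons)
    show ?thesis
    proof (cases a)
      case Nil
      have "t # w = [] @ s # w \<and> fully_cancelled [] = a \<and> fully_cancelled w = b"
        using * Nil by simp
      thus ?thesis by blast
    next
      case a: (Cons t1 a')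
      hence w: "fully_cancelled w = a' @ s # b" and t1: "t1 = t" using * by auto
      from Cons.IH[OF w] obtain u v where
        uv: "w = u @ s # v" "fully_cancelled u = a'" "fully_cancelled v = b" by blast
      have "push_sign t a' = t # a'"
        using keep(2) w by (cases t a' rule: push_sign_dichotomy) auto
      hence "t # w = (t # u) @ s # v" "fully_cancelled (t # u) = a"
        using uv a t1 by (simp_all add: fully_cancelled_Cons)
      with uv(3) show ?thesis by (intro exI[of _ "t # u"] exI[of _ v]) simp
    qed
  qed
qed simp

text \<open>
  The sign of \<open>s\<close> does not enter the condition; this is what makes the crystal operators invertible.
\<close>

definition splits_at :: "(sign \<times> 'x) list \<Rightarrow> (sign \<times> 'x) list \<Rightarrow> sign \<times> 'x \<Rightarrow> (sign \<times> 'x) list \<Rightarrow> bool"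
  where "splits_at w u s v \<longleftrightarrow>
    w = u @ s # v \<and> all_sign Mns (fully_cancelled u) \<and> all_sign Pls (fully_cancelled v)"

text \<open>
  After cancelling inside \<open>u\<close> and \<open>v\<close> the word is a sequence of minuses, then \<open>s\<close>, then a sequence of pluses;
  whichever sign \<open>s\<close> has, no plus precedes a minus.
\<close>

lemma fully_cancelled_splits_at:
  "splits_at w u s v \<Longrightarrow> fully_cancelled w = fully_cancelled u @ s # fully_cancelled v"
  by (auto simp: splits_at_def fully_cancelled_append fully_cancelled_Cons
      foldr_push_sign_Mns push_sign_Pls)

lemma sig_boxes_simps [simp]:
  "sig_boxes s [] = []"
  "sig_boxes s (p # w) = (if fst p = s then snd p # sig_boxes s w else sig_boxes s w)"
  "sig_boxes s (u @ v) = sig_boxes s u @ sig_boxes s v"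
  by (simp_all add: sig_boxes_def case_prod_unfold)

lemma sig_boxes_all_sign:
  "all_sign t w \<Longrightarrow> sig_boxes s w = (if s = t then map snd w else [])"
  by (induction w) auto

lemma sig_boxes_splits_at:
  assumes "splits_at w u (s, x) v"
  shows "sig_boxes Pls (fully_cancelled w) =
      (if s = Pls then [x] else []) @ map snd (fully_cancelled v)"
    "sig_boxes Mns (fully_cancelled w) =
      map snd (fully_cancelled u) @ (if s = Mns then [x] else [])"
  using assms unfolding fully_cancelled_splits_at[OF assms]
  by (auto simp: splits_at_def sig_boxes_all_sign)

lemma leftmost_plus_splits:
  assumes "sig_boxes Pls (fully_cancelled w) \<noteq> []"
  shows "\<exists>u v. splits_at w u (Pls, hd (sig_boxes Pls (fully_cancelled w))) v"
proof -
  obtain a b where ab: "fully_cancelled w = a @ b" "all_sign Mns a" "all_sign Pls b"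
    by (rule fully_cancelled_form)
  with assms obtain x b' where b: "b = (Pls, x) # b'"
    by (cases b) (auto simp: sig_boxes_all_sign)
  from fully_cancelled_split[of w a "(Pls, x)" b'] ab b show ?thesis
    by (auto simp: splits_at_def sig_boxes_all_sign)
qed

lemma rightmost_minus_splits:
  assumes "sig_boxes Mns (fully_cancelled w) \<noteq> []"
  shows "\<exists>u v. splits_at w u (Mns, last (sig_boxes Mns (fully_cancelled w))) v"
proof -
  obtain a b where ab: "fully_cancelled w = a @ b" "all_sign Mns a" "all_sign Pls b"
    by (rule fully_cancelled_form)
  with assms obtain x a' where a: "a = a' @ [(Mns, x)]"
    by (cases a rule: rev_cases) (auto simp: sig_boxes_all_sign)
  from fully_cancelled_split[of w a' "(Mns, x)" b] ab a show ?thesis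
    by (auto simp: splits_at_def sig_boxes_all_sign)
qed

text \<open>
  The invariant behind the relation between \<open>\<phi>\<^sub>i\<close>, \<open>\<epsilon>\<^sub>i\<close> and the weight: a cancellation removes one sign of
  each kind.
\<close>

lemma sign_balance_cancel_step:
  "cancel_step w w' \<Longrightarrow>
   int (length (sig_boxes Pls w)) - int (length (sig_boxes Mns w)) =
   int (length (sig_boxes Pls w')) - int (length (sig_boxes Mns w'))"
  by (induction rule: cancel_step.induct) simp

lemma sign_balance_fully_cancelled:
  "int (length (sig_boxes Pls (fully_cancelled w))) - int (length (sig_boxes Mns (fully_cancelled w)))
   = int (length (sig_boxes Pls w)) - int (length (sig_boxes Mns w))"
proof -
  have "cancel_step\<^sup>*\<^sup>* w (fully_cancelled w)"
    by (simp add: fully_cancelled_eq cancel_steps_foldr)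
  thus ?thesis
    by (induction rule: rtranclp_induct) (auto dest: sign_balance_cancel_step)
qed

text \<open>
  A final plus has no minus to its right to cancel with, so it would survive.
\<close>

lemma splits_at_not_after_plus:
  assumes "splits_at w (u @ [(Pls, y)]) s v" shows False
proof -
  have "fully_cancelled (u @ [(Pls, y)]) = foldr push_sign (fully_cancelled u) [(Pls, y)]"
    by (simp add: fully_cancelled_append fully_cancelled_Cons)
  \<comment> \<open>Prepending letters never removes a plus, as only a leading minus can disappear.\<close>
  moreover have "(Pls, y) \<in> set (foldr push_sign a [(Pls, y)])" for a :: "(sign \<times> 'a) list"
  proof (induction a)
    case (Cons p a)
    thus ?case by (cases p "foldr push_sign a [(Pls, y)]" rule: push_sign_dichotomy) auto
  qed simp
  ultimately show False using assms by (fastforce simp: splits_at_def all_sign_def)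
qed

lemma splits_at_not_before_minus:
  assumes "splits_at w u s ((Mns, y) # v)" shows False
  using assms by (auto simp: splits_at_def fully_cancelled_Cons)

section \<open>The reading order\<close>

definition read_before :: "box \<Rightarrow> box \<Rightarrow> bool" where
  "read_before x y \<longleftrightarrow> snd y < snd x \<or> snd x = snd y \<and> fst x < fst y"

lemma sorted_wrt_column_reading:
  assumes "sorted_wrt (<) rs" "sorted_wrt (>) cs"
  shows "sorted_wrt read_before [(r, c). c \<leftarrow> cs, r \<leftarrow> rs, (r, c) \<in> D]"
proof -
  have column: "sorted_wrt read_before [(r, c). r \<leftarrow> rs, (r, c) \<in> D]" for c
    using assms(1) by (induction rs) (auto simp: sorted_wrt_append read_before_def)
  show ?thesis
    using assms(2) column by (induction cs) (auto simp: sorted_wrt_append read_before_def)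
qed

lemma sorted_wrt_far_eastern: "sorted_wrt read_before (far_eastern_reading n lam)"
proof -
  have "sorted_wrt (<) [1..<n + 1]" by (rule sorted_wrt_upt)
  moreover have "sorted_wrt (>) (rev [1..<nat (lam 1) + 1])"
    unfolding sorted_wrt_rev by (simp del: upt_Suc)
  ultimately show ?thesis
    unfolding far_eastern_reading_def by (rule sorted_wrt_column_reading)
qed

lemma set_far_eastern:
  assumes "\<And>r. r \<in> {1..n} \<Longrightarrow> lam r \<le> lam 1"
  shows "set (far_eastern_reading n lam) = young_diagram n lam"
proof -
  have "c < nat (lam 1) + 1" if "(r, c) \<in> young_diagram n lam" for r c
    using that assms[of r] by (auto simp: young_diagram_def)
  hence "(r, c) \<in> set (far_eastern_reading n lam) \<longleftrightarrow> (r, c) \<in> young_diagram n lam" for r c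
    by (auto simp: far_eastern_reading_def young_diagram_def simp del: upt_Suc)
  thus ?thesis by auto
qed

lemma sign_word_eq:
  "sign_word n lam i T = map (\<lambda>x. (if T x = i then Pls else Mns, x))
     (filter (\<lambda>x. T x = i \<or> T x = i + 1) (far_eastern_reading n lam))"
proof -
  have "concat (map (\<lambda>x. if P x then [h x] else []) xs) = map h (filter P xs)"
    for P :: "box \<Rightarrow> bool" and h :: "box \<Rightarrow> sign \<times> box" and xs
    by (induction xs) auto
  thus ?thesis by (simp add: sign_word_def)
qed

lemma read_before_irrefl [simp]: "\<not> read_before x x"
  by (simp add: read_before_def)

lemma read_before_asym: "read_before x y \<Longrightarrow> \<not> read_before y x"
  by (auto simp: read_before_def)

lemma distinct_far_eastern: "distinct (far_eastern_reading n lam)"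
proof -
  have "sorted_wrt read_before xs \<Longrightarrow> distinct xs" for xs
    by (induction xs) auto
  thus ?thesis using sorted_wrt_far_eastern by blast
qed

text \<open>
  In a sorted word, boxes with no letter of the word strictly between them are neighbours.  This turns
  statements about the geometry of the diagram into statements about consecutive signs.
\<close>

lemma adjacent_after:
  assumes "sorted_wrt read_before (map snd (u @ s # v))"
    and "p \<in> set (u @ s # v)" "read_before (snd s) (snd p)"
    and "\<And>q. \<lbrakk>q \<in> set (u @ s # v); read_before (snd s) (snd q)\<rbrakk> \<Longrightarrow> \<not> read_before (snd q) (snd p)"
  shows "\<exists>v'. v = p # v'"
proof -
  have "p \<in> set v" using assms(1-3)
    by (auto simp: sorted_wrt_append dest: read_before_asym)
  then obtain q v' where v: "v = q # v'" by (cases v) auto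
  have "read_before (snd s) (snd q)" using assms(1) v by (simp add: sorted_wrt_append)
  hence "\<not> read_before (snd q) (snd p)" using assms(4)[of q] v by simp
  hence "p = q" using assms(1) v \<open>p \<in> set v\<close> by (auto simp: sorted_wrt_append)
  thus ?thesis using v by blast
qed

lemma adjacent_before:
  assumes "sorted_wrt read_before (map snd (u @ s # v))"
    and "p \<in> set (u @ s # v)" "read_before (snd p) (snd s)"
    and "\<And>q. \<lbrakk>q \<in> set (u @ s # v); read_before (snd q) (snd s)\<rbrakk> \<Longrightarrow> \<not> read_before (snd p) (snd q)"
  shows "\<exists>u'. u = u' @ [p]"
proof -
  have "p \<in> set u" using assms(1-3)
    by (auto simp: sorted_wrt_append dest: read_before_asym)
  then obtain q u' where u: "u = u' @ [q]" by (cases u rule: rev_cases) auto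
  have "read_before (snd q) (snd s)" using assms(1) u by (simp add: sorted_wrt_append)
  hence "\<not> read_before (snd p) (snd q)" using assms(4)[of q] u by simp
  hence "p = q" using assms(1) u \<open>p \<in> set u\<close> by (auto simp: sorted_wrt_append)
  thus ?thesis using u by blast
qed

section \<open>The crystal of semistandard tableaux\<close>

lemma dominant_lam_antimono:
  assumes "lam \<in> dominant_weights n" "1 \<le> r'" "r' \<le> r"
  shows "lam r \<le> lam r'"
proof -
  obtain a where a: "lam = lincomb {1..n} a fund_weight" "\<forall>i\<in>{1..n}. a i \<ge> 0"
    using assms(1) by (auto simp: dominant_weights_def)
  have "(\<Sum>j\<in>{r..n}. a j) \<le> (\<Sum>j\<in>{r'..n}. a j)"
    by (rule sum_mono2) (use assms a in auto)
  moreover have "lam k = (\<Sum>j\<in>{k..n}. a j)" if "k \<ge> 1" for k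
    unfolding a(1) lincomb_fund_weight_apply using that by simp
  ultimately show ?thesis using assms(2,3) by simp
qed

lemma tableau_wt_apply:
  "tableau_wt n lam T j = (if j \<in> {1..n + 1}
     then int (entry_count n lam T j) - int (entry_count n lam T (n + 1)) else 0)"
proof -
  have "lincomb {1..n + 1} a epsilon k = a k" if "k \<in> {1..n + 1}" for a k
  proof -
    have "lincomb {1..n + 1} a epsilon k = (\<Sum>j\<in>{1..n + 1}. if j = k then a j else 0)"
      unfolding lincomb_apply by (rule sum.cong) (auto simp: epsilon_def)
    thus ?thesis using that by simp
  qed
  thus ?thesis unfolding tableau_wt_def to_P_def by simp
qed

lemma coroot_pairing_eq: "i \<in> {1..m} \<Longrightarrow> coroot_pairing m i v = v i - v (i + 1)"
proof -
  assume i: "i \<in> {1..m}"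
  have "coroot_pairing m i v =
      (\<Sum>j\<in>{1..m + 1}. (if i = j then v j else 0) - (if i + 1 = j then v j else 0))"
    unfolding coroot_pairing_def by (rule sum.cong) auto
  thus ?thesis using i by (simp add: sum_subtractf)
qed

locale dominant =
  fixes n :: nat and lam :: "nat \<Rightarrow> int"
  assumes dominant: "lam \<in> dominant_weights n"
begin

abbreviation "D \<equiv> young_diagram n lam"

lemma diagram_closed: "\<lbrakk>(r, c) \<in> D; 1 \<le> r'; r' \<le> r; 1 \<le> c'; c' \<le> c\<rbrakk> \<Longrightarrow> (r', c') \<in> D"
  using dominant_lam_antimono[OF dominant, of r' r] by (auto simp: young_diagram_def)

lemma diagram_pos: "(r, c) \<in> D \<Longrightarrow> 1 \<le> r \<and> 1 \<le> c"
  by (auto simp: young_diagram_def)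

lemma set_reading: "set (far_eastern_reading n lam) = D"
  by (rule set_far_eastern) (use dominant_lam_antimono[OF dominant] in auto)

lemma finite_diagram [simp]: "finite D"
  unfolding set_reading[symmetric] by simp

lemma set_sign_word:
  "set (sign_word n lam i T) = {(Pls, x) | x. x \<in> D \<and> T x = i} \<union> {(Mns, x) | x. x \<in> D \<and> T x = i + 1}"
  by (auto simp: sign_word_eq set_reading image_iff)

lemma sorted_sign_word: "sorted_wrt read_before (map snd (sign_word n lam i T))"
proof -
  have "map snd (sign_word n lam i T)
      = filter (\<lambda>x. T x = i \<or> T x = i + 1) (far_eastern_reading n lam)"
    by (simp add: sign_word_eq o_def)
  thus ?thesis by (simp only: sorted_wrt_filter sorted_wrt_far_eastern)
qed

text \<open>
  Before any cancellation the signs count the entries \<open>i\<close> and \<open>i + 1\<close>, which links the signature to the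
  weight.
\<close>

lemma length_sig_boxes_sign_word:
  "length (sig_boxes Pls (sign_word n lam i T)) = entry_count n lam T i"
  "length (sig_boxes Mns (sign_word n lam i T)) = entry_count n lam T (i + 1)"
proof -
  have "sig_boxes Pls (sign_word n lam i T) = filter (\<lambda>x. T x = i) (far_eastern_reading n lam)"
    "sig_boxes Mns (sign_word n lam i T) = filter (\<lambda>x. T x = i + 1) (far_eastern_reading n lam)"
    unfolding sign_word_eq by (induction ("far_eastern_reading n lam")) auto
  moreover have "length (filter P (far_eastern_reading n lam)) = card {x \<in> D. P x}" for P
    using distinct_card[OF distinct_filter[OF distinct_far_eastern], of P n lam]
    by (simp add: set_reading)
  ultimately show "length (sig_boxes Pls (sign_word n lam i T)) = entry_count n lam T i"
    "length (sig_boxes Mns (sign_word n lam i T)) = entry_count n lam T (i + 1)"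
    by (simp_all add: entry_count_def)
qed

lemma sign_word_update:
  assumes word: "sign_word n lam i T = u @ (s, x) # v"
    and s': "s' = Pls \<and> a = i \<or> s' = Mns \<and> a = i + 1"
  shows "sign_word n lam i (T(x := a)) = u @ (s', x) # v"
proof -
  let ?g = "\<lambda>p. if snd p = x then (s', x) else p"
  have "distinct (map snd (sign_word n lam i T))"
    unfolding sign_word_eq using distinct_far_eastern by (simp add: o_def)
  hence x: "x \<notin> snd ` set u" "x \<notin> snd ` set v"
    unfolding word by auto
  have "(s, x) \<in> set (sign_word n lam i T)" using word by simp
  hence "T x = i \<or> T x = i + 1" by (auto simp: set_sign_word)
  hence "sign_word n lam i (T(x := a)) = map ?g (sign_word n lam i T)"
    unfolding sign_word_eq map_map using s'
    by (auto simp: o_def intro!: map_cong filter_cong)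
  also have "\<dots> = map ?g u @ (s', x) # map ?g v" unfolding word by simp
  also have "map ?g u = u" by (rule map_idI) (use x(1) in force)
  also have "map ?g v = v" by (rule map_idI) (use x(2) in force)
  finally show ?thesis .
qed

text \<open>
  The leftmost plus and the rightmost minus of the signature are exactly the places at which the sign word
  splits, with the respective sign.
\<close>

lemma tableau_f_iff:
  "tableau_f n lam i T = Some T' \<longleftrightarrow>
   (\<exists>u x v. splits_at (sign_word n lam i T) u (Pls, x) v \<and> T' = T(x := i + 1))"
proof
  assume "tableau_f n lam i T = Some T'"
  thus "\<exists>u x v. splits_at (sign_word n lam i T) u (Pls, x) v \<and> T' = T(x := i + 1)"
    using leftmost_plus_splits[of "sign_word n lam i T"]
    by (fastforce simp: tableau_f_def signature_def Let_def split: if_splits)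
qed (auto simp: tableau_f_def signature_def sig_boxes_splits_at)

lemma tableau_e_iff:
  "tableau_e n lam i T = Some T' \<longleftrightarrow>
   (\<exists>u x v. splits_at (sign_word n lam i T) u (Mns, x) v \<and> T' = T(x := i))"
proof
  assume "tableau_e n lam i T = Some T'"
  thus "\<exists>u x v. splits_at (sign_word n lam i T) u (Mns, x) v \<and> T' = T(x := i)"
    using rightmost_minus_splits[of "sign_word n lam i T"]
    by (fastforce simp: tableau_e_def signature_def Let_def split: if_splits)
qed (auto simp: tableau_e_def signature_def sig_boxes_splits_at)

lemma splits_at_box:
  assumes "splits_at (sign_word n lam i T) u (s, x) v"
  shows "x \<in> D" "T x = (if s = Pls then i else i + 1)"
proof -
  have "(s, x) \<in> set (sign_word n lam i T)" using assms by (simp add: splits_at_def)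
  thus "x \<in> D" "T x = (if s = Pls then i else i + 1)" by (auto simp: set_sign_word)
qed

lemma splits_at_update:
  assumes "splits_at (sign_word n lam i T) u (s, x) v"
    and "s' = Pls \<and> a = i \<or> s' = Mns \<and> a = i + 1"
  shows "splits_at (sign_word n lam i (T(x := a))) u (s', x) v"
  using assms sign_word_update[of i T u s x v s' a] by (auto simp: splits_at_def)

text \<open>
  Changing the sign at a splitting place leaves it a splitting place, and changing it back restores the
  tableau.
\<close>

lemma tableau_f_iff_e: "tableau_f n lam i T = Some T' \<longleftrightarrow> tableau_e n lam i T' = Some T"
proof
  assume "tableau_f n lam i T = Some T'"
  then obtain u x v where *: "splits_at (sign_word n lam i T) u (Pls, x) v" "T' = T(x := i + 1)"
    by (auto simp: tableau_f_iff)
  from splits_at_update[OF *(1), of Mns "i + 1"] splits_at_box(2)[OF *(1)] *(2)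
  show "tableau_e n lam i T' = Some T"
    unfolding tableau_e_iff by (intro exI[of _ u] exI[of _ x] exI[of _ v]) auto
next
  assume "tableau_e n lam i T' = Some T"
  then obtain u x v where *: "splits_at (sign_word n lam i T') u (Mns, x) v" "T = T'(x := i)"
    by (auto simp: tableau_e_iff)
  from splits_at_update[OF *(1), of Pls i] splits_at_box(2)[OF *(1)] *(2)
  show "tableau_f n lam i T = Some T'"
    unfolding tableau_f_iff by (intro exI[of _ u] exI[of _ x] exI[of _ v]) auto
qed

lemma ssyt_row:
  "\<lbrakk>T \<in> ssyt n lam; (r, c) \<in> D; (r, c') \<in> D; c \<le> c'\<rbrakk> \<Longrightarrow> T (r, c) \<le> T (r, c')"
  by (cases "c = c'") (auto simp: ssyt_def)

lemma ssyt_column: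
  "\<lbrakk>T \<in> ssyt n lam; (r, c) \<in> D; (r', c) \<in> D; r < r'\<rbrakk> \<Longrightarrow> T (r, c) < T (r', c)"
  by (auto simp: ssyt_def)

lemma fillings_update:
  "\<lbrakk>T \<in> fillings n lam; x \<in> D; a \<in> {1..n + 1}\<rbrakk> \<Longrightarrow> T(x := a) \<in> fillings n lam"
  by (auto simp: fillings_def PiE_iff extensional_def)

text \<open>
  Raising \<open>i\<close> by one can only hurt an equal entry to the right or an entry \<open>i + 1\<close> below.
\<close>

lemma ssyt_raise_entry:
  assumes T: "T \<in> ssyt n lam" and x: "(r, c) \<in> D" "T (r, c) = i" "i \<in> {1..n}"
    and right: "\<And>c'. \<lbrakk>(r, c') \<in> D; c < c'\<rbrakk> \<Longrightarrow> T (r, c') \<noteq> i"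
    and below: "\<And>r'. \<lbrakk>(r', c) \<in> D; r < r'\<rbrakk> \<Longrightarrow> T (r', c) \<noteq> i + 1"
  shows "T((r, c) := i + 1) \<in> ssyt n lam"
proof -
  have "T((r, c) := i + 1) \<in> fillings n lam"
    by (rule fillings_update) (use T x in \<open>auto simp: ssyt_def\<close>)
  moreover have "i + 1 \<le> T (r, c')" if "(r, c') \<in> D" "c < c'" for c'
    using ssyt_row[OF T x(1) that(1)] right[OF that] that x(2) by simp
  moreover have "i + 1 < T (r', c)" if "(r', c) \<in> D" "r < r'" for r'
    using ssyt_column[OF T x(1) that] below[OF that] x(2) by simp
  moreover have "T (r, c') \<le> i + 1" if "(r, c') \<in> D" "c' < c" for c'
    using ssyt_row[OF T that(1) x(1)] that x(2) by simp
  moreover have "T (r', c) < i + 1" if "(r', c) \<in> D" "r' < r" for r'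
    using ssyt_column[OF T that(1) x(1) that(2)] x(2) by simp
  ultimately show ?thesis using T by (auto simp: ssyt_def)
qed

lemma ssyt_lower_entry:
  assumes T: "T \<in> ssyt n lam" and x: "(r, c) \<in> D" "T (r, c) = i + 1" "i \<in> {1..n}"
    and left: "\<And>c'. \<lbrakk>(r, c') \<in> D; c' < c\<rbrakk> \<Longrightarrow> T (r, c') \<noteq> i + 1"
    and above: "\<And>r'. \<lbrakk>(r', c) \<in> D; r' < r\<rbrakk> \<Longrightarrow> T (r', c) \<noteq> i"
  shows "T((r, c) := i) \<in> ssyt n lam"
proof -
  have "T((r, c) := i) \<in> fillings n lam"
    by (rule fillings_update) (use T x in \<open>auto simp: ssyt_def\<close>)
  moreover have "T (r, c') \<le> i" if "(r, c') \<in> D" "c' < c" for c'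
    using ssyt_row[OF T that(1) x(1)] left[OF that] that x(2) by simp
  moreover have "T (r', c) < i" if "(r', c) \<in> D" "r' < r" for r'
    using ssyt_column[OF T that(1) x(1) that(2)] above[OF that] x(2) by simp
  moreover have "i \<le> T (r, c')" if "(r, c') \<in> D" "c < c'" for c'
    using ssyt_row[OF T x(1) that(1)] that x(2) by simp
  moreover have "i < T (r', c)" if "(r', c) \<in> D" "r < r'" for r'
    using ssyt_column[OF T x(1) that] x(2) by simp
  ultimately show ?thesis using T by (auto simp: ssyt_def)
qed

text \<open>
  An entry \<open>i + 1\<close> below the changed box is the next sign read after it, and would be a forbidden minus.
  An entry \<open>i\<close> to its right may be assumed in the adjacent column; it is the sign read just before the changed
  box and would be a forbidden plus.  The only sign that could intervene is an entry \<open>i + 1\<close> lower in the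
  adjacent column, and that one forces an entry \<open>i + 1\<close> below the changed box.
\<close>

lemma tableau_f_ssyt:
  assumes i: "i \<in> {1..n}" and T: "T \<in> ssyt n lam" and f: "tableau_f n lam i T = Some T'"
  shows "T' \<in> ssyt n lam"
proof -
  obtain u r c v where split: "splits_at (sign_word n lam i T) u (Pls, (r, c)) v"
    and T': "T' = T((r, c) := i + 1)"
    using f by (auto simp: tableau_f_iff)
  have word: "sign_word n lam i T = u @ (Pls, (r, c)) # v" using split by (simp add: splits_at_def)
  note sorted = sorted_sign_word[of i T, unfolded word]
  note signs = set_sign_word[of i T, unfolded word]
  have x: "(r, c) \<in> D" "T (r, c) = i" using splits_at_box[OF split] by auto
  have below: "T (r', c) \<noteq> i + 1" if r': "(r', c) \<in> D" "r < r'" for r'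
  proof
    assume eq: "T (r', c) = i + 1"
    have mem: "(Mns, (r', c)) \<in> set (u @ (Pls, (r, c)) # v)"
      unfolding signs using r' eq by simp
    have "\<exists>v'. v = (Mns, (r', c)) # v'"
    proof (rule adjacent_after[OF sorted mem])
      fix q assume q: "q \<in> set (u @ (Pls, (r, c)) # v)"
        "read_before (snd (Pls, (r, c))) (snd q)"
      obtain t a b where [simp]: "q = (t, (a, b))" by (cases q) auto
      have D: "(a, b) \<in> D" using q(1) unfolding signs by auto
      show "\<not> read_before (snd q) (snd (Mns, (r', c)))"
      proof
        assume "read_before (snd q) (snd (Mns, (r', c)))"
        hence "b = c" "r < a" "a < r'" using q(2) by (auto simp: read_before_def)
        thus False
          using ssyt_column[OF T x(1), of a] ssyt_column[OF T _ r'(1), of a] D x(2) eq by auto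
      qed
    qed (use r' eq in \<open>auto simp: read_before_def\<close>)
    thus False using splits_at_not_before_minus split by metis
  qed
  have right: "T (r, c') \<noteq> i" if c': "(r, c') \<in> D" "c < c'" for c'
  proof
    assume eq: "T (r, c') = i"
    \<comment> \<open>Rows increase weakly, so the entry \<open>i\<close> already occurs in the adjacent column.\<close>
    have y: "(r, c + 1) \<in> D" using diagram_closed[OF c'(1), of r "c + 1"] c'(2) diagram_pos[OF x(1)] by simp
    have "T (r, c + 1) = i"
      using ssyt_row[OF T x(1) y] ssyt_row[OF T y c'(1)] x(2) eq c'(2) by simp
    have mem: "(Pls, (r, c + 1)) \<in> set (u @ (Pls, (r, c)) # v)"
      unfolding signs using y \<open>T (r, c + 1) = i\<close> by simp
    have "\<exists>u'. u = u' @ [(Pls, (r, c + 1))]"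
    proof (rule adjacent_before[OF sorted mem])
      fix q assume q: "q \<in> set (u @ (Pls, (r, c)) # v)"
        "read_before (snd q) (snd (Pls, (r, c)))"
      obtain t a b where [simp]: "q = (t, (a, b))" by (cases q) auto
      have D: "(a, b) \<in> D" and ab: "T (a, b) = i \<or> T (a, b) = i + 1"
        using q(1) unfolding signs by auto
      show "\<not> read_before (snd (Pls, (r, c + 1))) (snd q)"
      proof
        assume "read_before (snd (Pls, (r, c + 1))) (snd q)"
        \<comment> \<open>The boxes read in between: the rest of column \<open>c + 1\<close>, then the top of column \<open>c\<close>.\<close>
        then consider "b = c + 1" "r < a" | "b = c" "a < r"
          using q(2) by (auto simp: read_before_def)
        thus False
        proof cases
          case 1
          have ac: "(a, c) \<in> D" using diagram_closed[OF D, of a c] diagram_pos[OF D] diagram_pos[OF x(1)] 1 by simp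
          have "T (a, b) = i + 1"
            using ssyt_column[OF T y, of a] D ab 1 \<open>T (r, c + 1) = i\<close> by auto
          hence "T (a, c) = i + 1"
            using ssyt_row[OF T ac D] ssyt_column[OF T x(1) ac 1(2)] x(2) 1 by simp
          thus False using below[OF ac 1(2)] by simp
        next
          case 2
          thus False using ssyt_column[OF T _ x(1), of a] D ab x(2) by auto
        qed
      qed
    qed (use y \<open>T (r, c + 1) = i\<close> in \<open>auto simp: read_before_def\<close>)
    thus False using splits_at_not_after_plus split by metis
  qed
  show ?thesis unfolding T' by (rule ssyt_raise_entry) (use T x i right below in auto)
qed

text \<open>
  The mirror image of the preceding argument: an entry \<open>i\<close> above would be a plus read just before the changed
  box, and an entry \<open>i + 1\<close> in the adjacent column to the left a minus read just after it, unless an entry \<open>i\<close>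
  higher in that column intervenes, which forces an entry \<open>i\<close> above the changed box.
\<close>

lemma tableau_e_ssyt:
  assumes i: "i \<in> {1..n}" and T: "T \<in> ssyt n lam" and e: "tableau_e n lam i T = Some T'"
  shows "T' \<in> ssyt n lam"
proof -
  obtain u r c v where split: "splits_at (sign_word n lam i T) u (Mns, (r, c)) v"
    and T': "T' = T((r, c) := i)"
    using e by (auto simp: tableau_e_iff)
  have word: "sign_word n lam i T = u @ (Mns, (r, c)) # v" using split by (simp add: splits_at_def)
  note sorted = sorted_sign_word[of i T, unfolded word]
  note signs = set_sign_word[of i T, unfolded word]
  have x: "(r, c) \<in> D" "T (r, c) = i + 1" using splits_at_box[OF split] by auto
  have above: "T (r', c) \<noteq> i" if r': "(r', c) \<in> D" "r' < r" for r'
  proof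
    assume eq: "T (r', c) = i"
    have mem: "(Pls, (r', c)) \<in> set (u @ (Mns, (r, c)) # v)"
      unfolding signs using r' eq by simp
    have "\<exists>u'. u = u' @ [(Pls, (r', c))]"
    proof (rule adjacent_before[OF sorted mem])
      fix q assume q: "q \<in> set (u @ (Mns, (r, c)) # v)"
        "read_before (snd q) (snd (Mns, (r, c)))"
      obtain t a b where [simp]: "q = (t, (a, b))" by (cases q) auto
      have D: "(a, b) \<in> D" using q(1) unfolding signs by auto
      show "\<not> read_before (snd (Pls, (r', c))) (snd q)"
      proof
        assume "read_before (snd (Pls, (r', c))) (snd q)"
        hence "b = c" "r' < a" "a < r" using q(2) by (auto simp: read_before_def)
        thus False
          using ssyt_column[OF T r'(1), of a] ssyt_column[OF T _ x(1), of a] D x(2) eq by auto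
      qed
    qed (use r' eq in \<open>auto simp: read_before_def\<close>)
    thus False using splits_at_not_after_plus split by metis
  qed
  have left: "T (r, c') \<noteq> i + 1" if c': "(r, c') \<in> D" "c' < c" for c'
  proof
    assume eq: "T (r, c') = i + 1"
    define d where "d = c - 1"
    have d: "c = d + 1" "c' \<le> d" using c'(2) by (auto simp: d_def)
    have y: "(r, d) \<in> D"
      using diagram_closed[OF x(1), of r d] d diagram_pos[OF c'(1)] diagram_pos[OF x(1)] by simp
    have "T (r, d) = i + 1"
      using ssyt_row[OF T y x(1)] ssyt_row[OF T c'(1) y] x(2) eq d by simp
    have mem: "(Mns, (r, d)) \<in> set (u @ (Mns, (r, c)) # v)"
      unfolding signs using y d(1) \<open>T (r, d) = i + 1\<close> by simp
    have "\<exists>v'. v = (Mns, (r, d)) # v'"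
    proof (rule adjacent_after[OF sorted mem])
      fix q assume q: "q \<in> set (u @ (Mns, (r, c)) # v)"
        "read_before (snd (Mns, (r, c))) (snd q)"
      obtain t a b where [simp]: "q = (t, (a, b))" by (cases q) auto
      have D: "(a, b) \<in> D" and ab: "T (a, b) = i \<or> T (a, b) = i + 1"
        using q(1) unfolding signs by auto
      show "\<not> read_before (snd q) (snd (Mns, (r, d)))"
      proof
        assume "read_before (snd q) (snd (Mns, (r, d)))"
        \<comment> \<open>The boxes read in between: the top of column \<open>d\<close> and the rest of column \<open>c\<close>.\<close>
        then consider "b = d" "a < r" | "b = c" "r < a"
          using q(2) d(1) by (auto simp: read_before_def)
        thus False
        proof cases
          case 1
          have ac: "(a, c) \<in> D" using diagram_closed[OF x(1), of a c] diagram_pos[OF D] diagram_pos[OF x(1)] 1 by simp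
          have "T (a, b) = i"
            using ssyt_column[OF T _ y, of a] D ab 1 \<open>T (r, d) = i + 1\<close> by auto
          hence "T (a, c) = i"
            using ssyt_row[OF T D ac] ssyt_column[OF T ac x(1) 1(2)] x(2) 1 d(1) by simp
          thus False using above[OF ac 1(2)] by simp
        next
          case 2
          thus False using ssyt_column[OF T x(1), of a] D ab x(2) by auto
        qed
      qed
    qed (use y d(1) \<open>T (r, d) = i + 1\<close> in \<open>auto simp: read_before_def\<close>)
    thus False using splits_at_not_before_minus split by metis
  qed
  show ?thesis unfolding T' by (rule ssyt_lower_entry) (use T x i left above in auto)
qed

lemma tableau_f_signature_length:
  assumes "tableau_f n lam i T = Some T'"
  shows "length (sig_boxes Pls (signature n lam i T)) = length (sig_boxes Pls (signature n lam i T')) + 1"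
    "length (sig_boxes Mns (signature n lam i T')) = length (sig_boxes Mns (signature n lam i T)) + 1"
proof -
  obtain u x v where *: "splits_at (sign_word n lam i T) u (Pls, x) v" "T' = T(x := i + 1)"
    using assms by (auto simp: tableau_f_iff)
  from splits_at_update[OF *(1), of Mns "i + 1"] *(2)
  have "splits_at (sign_word n lam i T') u (Mns, x) v" by simp
  from sig_boxes_splits_at[OF this] sig_boxes_splits_at[OF *(1)]
  show "length (sig_boxes Pls (signature n lam i T)) = length (sig_boxes Pls (signature n lam i T')) + 1"
    "length (sig_boxes Mns (signature n lam i T')) = length (sig_boxes Mns (signature n lam i T)) + 1"
    by (simp_all add: signature_def)
qed

lemma entry_count_eq_sum: "int (entry_count n lam T a) = (\<Sum>y\<in>D. of_bool (T y = a))"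
  by (simp add: entry_count_def Int_def sum.If_cases of_bool_def)

lemma entry_count_update:
  assumes "x \<in> D"
  shows "int (entry_count n lam (T(x := b)) a) =
    int (entry_count n lam T a) - of_bool (T x = a) + of_bool (b = a)"
  unfolding entry_count_eq_sum sum.remove[OF finite_diagram assms] by simp

lemma tableau_f_wt:
  assumes "tableau_f n lam i T = Some T'"
  shows "tableau_wt n lam T' = tableau_wt n lam T - to_P n (simple_root i)"
proof -
  obtain u x v where *: "splits_at (sign_word n lam i T) u (Pls, x) v" "T' = T(x := i + 1)"
    using assms by (auto simp: tableau_f_iff)
  have "int (entry_count n lam T' a) = int (entry_count n lam T a) - simple_root i a" for a
    using splits_at_box[OF *(1)] unfolding *(2)
    by (simp add: entry_count_update simple_root_def epsilon_def)
  thus ?thesis by (intro ext) (simp add: tableau_wt_apply to_P_def)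
qed

text \<open>
  The axioms for raising follow from those for lowering, since the two operators are mutually inverse.
\<close>

theorem crystal_A_ssyt: "crystal_A n (ssyt_crystal n lam)"
proof -
  have phi_eps: "tableau_phi n lam i T = tableau_eps n lam i T + Fin (coroot_pairing n i (tableau_wt n lam T))"
    if i: "i \<in> {1..n}" for i T
    using i sign_balance_fully_cancelled[of "sign_word n lam i T"]
    by (simp add: tableau_phi_def tableau_eps_def coroot_pairing_eq tableau_wt_apply
        length_sig_boxes_sign_word signature_def)
  have f: "tableau_eps n lam i T' = tableau_eps n lam i T + 1"
    "tableau_phi n lam i T' = tableau_phi n lam i T - 1"
    "tableau_eps n lam i T = tableau_eps n lam i T' - 1"
    "tableau_phi n lam i T = tableau_phi n lam i T' + 1"
    "tableau_wt n lam T = tableau_wt n lam T' + to_P n (simple_root i)"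
    if "tableau_f n lam i T = Some T'" for i T T'
    using tableau_f_signature_length[OF that] tableau_f_wt[OF that]
    by (simp_all add: tableau_eps_def tableau_phi_def one_extended_def)
  show ?thesis
  proof (rule crystal_A.intro, unfold ssyt_crystal_def crystal.simps)
    fix i T T'
    show "tableau_wt n lam T \<in> weight_lattice n"
      by (simp add: tableau_wt_def to_P_in_weight_lattice)
    show "tableau_eps n lam i T \<noteq> \<infinity>" "tableau_phi n lam i T \<noteq> \<infinity>"
      by (simp_all add: tableau_eps_def tableau_phi_def)
    show "tableau_e n lam i T = None \<and> tableau_f n lam i T = None" if "tableau_phi n lam i T = -\<infinity>"
      using that by (simp add: tableau_phi_def)
    show "tableau_f n lam i T = Some T' \<longleftrightarrow> tableau_e n lam i T' = Some T"
      by (rule tableau_f_iff_e)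
    assume i: "i \<in> {1..n}"
    show "tableau_phi n lam i T =
        tableau_eps n lam i T + Fin (coroot_pairing n i (tableau_wt n lam T))"
      using i by (rule phi_eps)
    show "T' \<in> ssyt n lam" if "T \<in> ssyt n lam" "tableau_e n lam i T = Some T'"
      using i that by (rule tableau_e_ssyt)
    show "T' \<in> ssyt n lam" if "T \<in> ssyt n lam" "tableau_f n lam i T = Some T'"
      using i that by (rule tableau_f_ssyt)
  next
    fix i T T' assume "tableau_e n lam i T = Some T'"
    hence "tableau_f n lam i T' = Some T" by (simp only: tableau_f_iff_e)
    from f(5,3,4)[OF this] show "tableau_wt n lam T' = tableau_wt n lam T + to_P n (simple_root i)"
      "tableau_eps n lam i T' = tableau_eps n lam i T - 1"
      "tableau_phi n lam i T' = tableau_phi n lam i T + 1" .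
  next
    fix i T T' assume "tableau_f n lam i T = Some T'"
    from tableau_f_wt[OF this] f(1,2)[OF this]
    show "tableau_wt n lam T' = tableau_wt n lam T - to_P n (simple_root i)"
      "tableau_eps n lam i T' = tableau_eps n lam i T + 1"
      "tableau_phi n lam i T' = tableau_phi n lam i T - 1" .
  qed
qed

end

section \<open>Twisting a crystal by the longest Weyl group element\<close>

text \<open>
  The subtracted term is the coefficient that \<open>w\<^sub>0\<close> moves to position \<open>n + 1\<close>, where representatives in the
  weight lattice vanish.
\<close>

lemma w0_action_apply:
  "w0_action n v k = (if k \<in> {1..n + 1} then v (n + 2 - k) - v 1 else 0)"
proof -
  have *: "lincomb {1..n + 1} v (\<lambda>j. epsilon (n + 2 - j)) k = v (n + 2 - k)"
    if "k \<in> {1..n + 1}" for k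
  proof -
    have "lincomb {1..n + 1} v (\<lambda>j. epsilon (n + 2 - j)) k =
        (\<Sum>j\<in>{1..n + 1}. if j = n + 2 - k then v j else 0)"
      unfolding lincomb_apply by (rule sum.cong) (use that in \<open>auto simp: epsilon_def\<close>)
    also have "\<dots> = v (n + 2 - k)"
      by (subst sum.delta) (use that in auto)
    finally show ?thesis .
  qed
  have "n + 1 \<in> {1..n + 1}" "n + 2 - (n + 1) = 1" by auto
  thus ?thesis using *[of k] *[of "n + 1"] unfolding w0_action_def to_P_def by metis
qed

lemma w0_action_involution:
  assumes "v \<in> weight_lattice n" shows "w0_action n (w0_action n v) = v"
  using assms by (intro ext) (auto simp: w0_action_apply weight_lattice_iff)

lemma w0_action_add: "w0_action n (u + v) = w0_action n u + w0_action n v"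
  by (intro ext) (simp add: w0_action_apply)

lemma w0_action_diff: "w0_action n (u - v) = w0_action n u - w0_action n v"
  by (intro ext) (simp add: w0_action_apply)

lemma w0_action_simple_root:
  assumes "i \<in> {1..n}"
  shows "w0_action n (to_P n (simple_root (n + 1 - i))) = - to_P n (simple_root i)"
proof
  fix k
  have flip: "simple_root (n + 1 - i) (n + 2 - j) = - simple_root i j" if "j \<in> {1..n + 1}" for j
  proof -
    have "n + 2 - j = n + 1 - i \<longleftrightarrow> j = i + 1" "n + 2 - j = n + 1 - i + 1 \<longleftrightarrow> j = i"
      using assms that by auto
    thus ?thesis by (simp only: simple_root_def epsilon_def fun_diff_def minus_diff_eq)
  qed
  have "n + 2 - k \<in> {1..n + 1}" if "k \<in> {1..n + 1}" using that by auto
  moreover have "n + 2 - (n + 1) = 1" "n + 1 \<in> {1..n + 1}" "1 \<in> {1..n + 1}" by auto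
  ultimately show "w0_action n (to_P n (simple_root (n + 1 - i))) k = (- to_P n (simple_root i)) k"
    using flip[of k] flip[of "n + 1"] unfolding w0_action_apply to_P_def fun_Compl_def
    by (cases "k \<in> {1..n + 1}") (simp_all only: if_True if_False)
qed

lemma coroot_pairing_w0_action:
  assumes "i \<in> {1..n}"
  shows "coroot_pairing n (n + 1 - i) (w0_action n v) = - coroot_pairing n i v"
proof -
  have "n + 1 - i \<in> {1..n}" "n + 2 - (n + 1 - i) = i + 1" "n + 2 - (n + 1 - i + 1) = i"
    using assms by auto
  thus ?thesis using assms by (simp add: coroot_pairing_eq w0_action_apply)
qed

text \<open>
  The dual of a crystal exchanges raising and lowering and negates weights; composing with the diagram
  automorphism \<open>i \<mapsto> n + 1 - i\<close> replaces the negation by \<open>w\<^sub>0\<close>.  Every axiom for \<open>B\<close> is the axiom for \<open>C\<close>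
  with the opposite operator at the opposite index; the weight axioms use in addition that \<open>w\<^sub>0\<close> is an
  involution on the weight lattice.
\<close>

lemma crystal_A_twist:
  fixes C :: "'c crystal" and F :: "'b \<Rightarrow> 'c" and A W n
  defines "B \<equiv> \<lparr>elems = A, wt = W,
      e_op = (\<lambda>i b. map_option (inv_into A F) (f_op C (n + 1 - i) (F b))),
      f_op = (\<lambda>i b. map_option (inv_into A F) (e_op C (n + 1 - i) (F b))),
      eps = (\<lambda>i b. phi C (n + 1 - i) (F b)),
      phi = (\<lambda>i b. eps C (n + 1 - i) (F b))\<rparr>"
  assumes C: "crystal_A n C" and F: "bij_betw F A (elems C)"
    and W: "\<And>b. b \<in> A \<Longrightarrow> W b \<in> weight_lattice n"
    and wt: "\<And>b. b \<in> A \<Longrightarrow> wt C (F b) = w0_action n (W b)"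
  shows "crystal_A n B" "crystal_anti_iso n F B C"
proof -
  interpret C: crystal_A n C by (rule C)
  have B: "elems B = A" "wt B = W"
    "e_op B i b = map_option (inv_into A F) (f_op C (n + 1 - i) (F b))"
    "f_op B i b = map_option (inv_into A F) (e_op C (n + 1 - i) (F b))"
    "eps B i b = phi C (n + 1 - i) (F b)" "phi B i b = eps C (n + 1 - i) (F b)" for i b
    by (simp_all add: B_def)
  have FA: "F b \<in> elems C" if "b \<in> A" for b using F that by (auto simp: bij_betw_def)
  have inv_F: "inv_into A F (F b) = b" if "b \<in> A" for b
    using F that by (simp add: bij_betw_def)
  have F_inv: "inv_into A F c \<in> A" "F (inv_into A F c) = c" if "c \<in> elems C" for c
    using F that by (auto simp: bij_betw_def inv_into_into f_inv_into_f)
  have dual: "n + 1 - i \<in> {1..n}" if "i \<in> {1..n}" for i using that by auto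
  have W_eq: "W b = w0_action n (wt C (F b))" if "b \<in> A" for b
    using that by (simp add: wt W w0_action_involution)
  have e: "b' \<in> A" "f_op C (n + 1 - i) (F b) = Some (F b')"
    if "i \<in> {1..n}" "b \<in> A" "e_op B i b = Some b'" for i b b'
    using that C.f_closed[OF dual FA] F_inv by (auto simp: B)
  have f: "b' \<in> A" "e_op C (n + 1 - i) (F b) = Some (F b')"
    if "i \<in> {1..n}" "b \<in> A" "f_op B i b = Some b'" for i b b'
    using that C.e_closed[OF dual FA] F_inv by (auto simp: B)
  have e_iff: "e_op B i b = Some b' \<longleftrightarrow> f_op C (n + 1 - i) (F b) = Some (F b')"
    if "i \<in> {1..n}" "b \<in> A" "b' \<in> A" for i b b'
    using e(2)[OF that(1,2)] that inv_F by (auto simp: B(3))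
  have f_iff: "f_op B i b = Some b' \<longleftrightarrow> e_op C (n + 1 - i) (F b) = Some (F b')"
    if "i \<in> {1..n}" "b \<in> A" "b' \<in> A" for i b b'
    using f(2)[OF that(1,2)] that inv_F by (auto simp: B(4))
  show "crystal_A n B"
  proof (rule crystal_A.intro, unfold B(1,2))
    fix b assume "b \<in> A" thus "W b \<in> weight_lattice n" by (rule W)
  next
    fix i b assume ib: "i \<in> {1..n}" "b \<in> A"
    note ib' = dual[OF ib(1)] FA[OF ib(2)]
    show "eps B i b \<noteq> \<infinity>" "phi B i b \<noteq> \<infinity>"
      using C.eps_closed[OF ib'] C.phi_closed[OF ib'] by (simp_all add: B)
    have eps_phi: "phi C (n + 1 - i) (F b) = eps C (n + 1 - i) (F b) + Fin (- coroot_pairing n i (W b))"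
      using C.phi_eps[OF ib'] by (simp only: wt[OF ib(2)] coroot_pairing_w0_action[OF ib(1)])
    \<comment> \<open>The pairing is finite, so it can be moved to the other side even when both values are \<open>-\<infinity>\<close>.\<close>
    thus "phi B i b = eps B i b + Fin (coroot_pairing n i (W b))"
      unfolding B by (cases "eps C (n + 1 - i) (F b)") simp_all
    show "e_op B i b = None \<and> f_op B i b = None" if "phi B i b = -\<infinity>"
    proof -
      have "phi C (n + 1 - i) (F b) = -\<infinity>" using eps_phi that by (simp add: B)
      thus ?thesis using C.phi_minf[OF ib'] by (simp add: B)
    qed
    show "f_op B i b = Some b' \<longleftrightarrow> e_op B i b' = Some b" if "b' \<in> A" for b'
      unfolding f_iff[OF ib that] e_iff[OF ib(1) that ib(2)]
      using C.f_iff_e[OF ib'(1) FA[OF that] ib'(2)] by simp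
  next
    fix i b b' assume ib: "i \<in> {1..n}" "b \<in> A" and "e_op B i b = Some b'"
    note e = e[OF this]
    note Ce = dual[OF ib(1)] FA[OF ib(2)] e(2)
    show "b' \<in> A" by (rule e)
    show "eps B i b' = eps B i b - 1" "phi B i b' = phi B i b + 1"
      using C.phi_f[OF Ce] C.eps_f[OF Ce] by (simp_all add: B)
    show "W b' = W b + to_P n (simple_root i)"
      unfolding W_eq[OF e(1)] W_eq[OF ib(2)] C.wt_f[OF Ce]
      by (simp only: w0_action_diff w0_action_simple_root[OF ib(1)] diff_minus_eq_add)
  next
    fix i b b' assume ib: "i \<in> {1..n}" "b \<in> A" and "f_op B i b = Some b'"
    note f = f[OF this]
    note Cf = dual[OF ib(1)] FA[OF ib(2)] f(2)
    show "b' \<in> A" by (rule f)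
    show "eps B i b' = eps B i b + 1" "phi B i b' = phi B i b - 1"
      using C.phi_e[OF Cf] C.eps_e[OF Cf] by (simp_all add: B)
    show "W b' = W b - to_P n (simple_root i)"
      unfolding W_eq[OF f(1)] W_eq[OF ib(2)] C.wt_e[OF Cf]
      by (simp only: w0_action_add w0_action_simple_root[OF ib(1)] diff_conv_add_uminus)
  qed
  have "map_option F (e_op B i b) = f_op C (n + 1 - i) (F b)"
    "map_option F (f_op B i b) = e_op C (n + 1 - i) (F b)" if "i \<in> {1..n}" "b \<in> A" for i b
    using that C.e_closed[OF dual FA] C.f_closed[OF dual FA] F_inv(2)
    by (auto simp: B option.map_comp o_def intro!: map_option_idI)
  thus "crystal_anti_iso n F B C"
    using F wt by (simp add: crystal_anti_iso_def B(1,2))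
qed

section \<open>Complementing the entries\<close>

lemma complement_map_involution:
  assumes "T \<in> fillings n lam"
  shows "complement_map n lam (complement_map n lam T) = T"
proof
  fix x
  show "complement_map n lam (complement_map n lam T) x = T x"
    using PiE_mem[OF assms[unfolded fillings_def], of x] PiE_arb[OF assms[unfolded fillings_def], of x]
    by (auto simp: complement_map_def restrict_def)
qed

lemma complement_map_fillings:
  "T \<in> fillings n lam \<Longrightarrow> complement_map n lam T \<in> fillings n lam"
  by (fastforce simp: fillings_def complement_map_def PiE_iff)

lemma complement_map_order_iff:
  assumes "T \<in> fillings n lam" "x \<in> young_diagram n lam" "y \<in> young_diagram n lam"
  shows "complement_map n lam T x < complement_map n lam T y \<longleftrightarrow> T y < T x"
    "complement_map n lam T x \<le> complement_map n lam T y \<longleftrightarrow> T y \<le> T x"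
proof -
  have "T x \<in> {1..n + 1}" "T y \<in> {1..n + 1}"
    using assms by (auto simp: fillings_def)
  thus "complement_map n lam T x < complement_map n lam T y \<longleftrightarrow> T y < T x"
    "complement_map n lam T x \<le> complement_map n lam T y \<longleftrightarrow> T y \<le> T x"
    using assms(2,3) by (auto simp: complement_map_def)
qed

lemma complement_map_ssyt_iff:
  assumes "T \<in> fillings n lam"
  shows "complement_map n lam T \<in> ssyt n lam \<longleftrightarrow> T \<in> reverse_ssyt n lam"
  by (simp add: ssyt_def reverse_ssyt_def assms complement_map_fillings complement_map_order_iff
      cong: conj_cong)

lemma bij_betw_complement_map:
  "bij_betw (complement_map n lam) (reverse_ssyt n lam) (ssyt n lam)"
proof (rule bij_betw_byWitness)
  have fillings: "T \<in> fillings n lam" if "T \<in> reverse_ssyt n lam \<or> T \<in> ssyt n lam" for T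
    using that by (auto simp: reverse_ssyt_def ssyt_def)
  show "\<forall>T\<in>reverse_ssyt n lam. complement_map n lam (complement_map n lam T) = T"
    "\<forall>T\<in>ssyt n lam. complement_map n lam (complement_map n lam T) = T"
    by (simp_all add: fillings complement_map_involution)
  show "complement_map n lam ` reverse_ssyt n lam \<subseteq> ssyt n lam"
    using fillings complement_map_ssyt_iff by auto
  show "complement_map n lam ` ssyt n lam \<subseteq> reverse_ssyt n lam"
  proof
    fix S assume "S \<in> complement_map n lam ` ssyt n lam"
    then obtain T where T: "T \<in> ssyt n lam" "S = complement_map n lam T" by blast
    hence "S \<in> fillings n lam" "complement_map n lam S = T"
      by (simp_all add: fillings complement_map_fillings complement_map_involution)
    thus "S \<in> reverse_ssyt n lam" using complement_map_ssyt_iff T(1) by blast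
  qed
qed

lemma entry_count_complement_map:
  assumes "T \<in> fillings n lam" "a \<in> {1..n + 1}"
  shows "entry_count n lam (complement_map n lam T) a = entry_count n lam T (n + 2 - a)"
proof -
  have "n + 2 - T x = a \<longleftrightarrow> T x = n + 2 - a" if "x \<in> young_diagram n lam" for x
    using PiE_mem[OF assms(1)[unfolded fillings_def] that] assms(2) by auto
  thus ?thesis
    unfolding entry_count_def
    by (intro arg_cong[of _ _ card]) (auto simp: complement_map_def)
qed

lemma tableau_wt_complement_map:
  assumes "T \<in> fillings n lam"
  shows "tableau_wt n lam (complement_map n lam T) = w0_action n (tableau_wt n lam T)"
  using assms by (intro ext) (auto simp: w0_action_apply tableau_wt_apply entry_count_complement_map)

theorem proposition2p10:
  fixes n :: nat and lam :: "nat \<Rightarrow> int"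
  assumes "lam \<in> dominant_weights n"
  shows "crystal_A n (reverse_ssyt_crystal n lam)
    \<and> crystal_anti_iso n (complement_map n lam) (reverse_ssyt_crystal n lam) (ssyt_crystal n lam)"
proof -
  interpret dominant n lam by unfold_locales (rule assms)
  have bij: "bij_betw (complement_map n lam) (reverse_ssyt n lam) (elems (ssyt_crystal n lam))"
    using bij_betw_complement_map by (simp add: ssyt_crystal_def)
  have lattice: "tableau_wt n lam T \<in> weight_lattice n" for T
    by (simp add: tableau_wt_def to_P_in_weight_lattice)
  have "wt (ssyt_crystal n lam) (complement_map n lam T) = w0_action n (tableau_wt n lam T)"
    if "T \<in> reverse_ssyt n lam" for T
    using that by (simp add: ssyt_crystal_def reverse_ssyt_def tableau_wt_complement_map)
  note twist = crystal_A_twist[OF crystal_A_ssyt bij lattice this]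
  have "reverse_ssyt_crystal n lam = \<lparr>elems = reverse_ssyt n lam, wt = tableau_wt n lam,
      e_op = (\<lambda>i T. map_option (inv_into (reverse_ssyt n lam) (complement_map n lam))
        (f_op (ssyt_crystal n lam) (n + 1 - i) (complement_map n lam T))),
      f_op = (\<lambda>i T. map_option (inv_into (reverse_ssyt n lam) (complement_map n lam))
        (e_op (ssyt_crystal n lam) (n + 1 - i) (complement_map n lam T))),
      eps = (\<lambda>i T. phi (ssyt_crystal n lam) (n + 1 - i) (complement_map n lam T)),
      phi = (\<lambda>i T. eps (ssyt_crystal n lam) (n + 1 - i) (complement_map n lam T))\<rparr>"
    by (simp add: reverse_ssyt_crystal_def ssyt_crystal_def Let_def)
  with twist show ?thesis by (simp only: simp_thms)
qed

end
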